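(* Let $A\in M_n(\mathbb{C})$, let $\lambda$ be an eigenvalue of $A$ with a Jordan block $J_r(\lambda)$ of size $r$, let $m\le r$ be a positive integer, let $x_m$ be a generalized eigenvector of rank $m$ of $A$ associated with $\lambda$, belonging to the Jordan chain $x_1,\dots,x_r$ described in the context, and let $b\in\mathbb{C}^n$ be an arbitrary vector. Then $$\big|\sigma(A+x_mb^* )\setminus\sigma(A)\big|\le m,$$ i.e., at most $m$ eigenvalues of $A+x_mb^*$ are different from those of $A$, with the $m$ eigenvalues being zeros of $$f(t)=(t-\lambda)^m-b^*\sum_{i=0}^{m-1}x_{i+1}(t-\lambda)^i .$$
   Context: $M_n(\mathbb{C})$ is the set of $n\times n$ complex matrices, $\sigma(A)$ denotes the spectrum of $A$, $|\alpha|$ the cardinality of a set $\alpha$, and $b^*$ the conjugate transpose of $b$. $J_r(\lambda)$ is the standard $r\times r$ upper triangular Jordan block with eigenvalue $\lambda$. A vector $x$ is a generalized eigenvector of rank $m$ of $A$ corresponding to $\lambda$ if $(A-\lambda I)^m x=0$ and $(A-\lambda I)^{m-1}x\ne 0$. For each $j$ with $1\le j\le r$, $x_j$ denotes a generalized eigenvector of rank $j$ of $A$ associated with $\lambda$, and these vectors form a Jordan chain: $Ax_j=\lambda x_j+x_{j-1}$ for $1\le j\le r$, where $x_0=0$. *)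

theory Defs
  imports
    "Jordan_Normal_Form.Jordan_Normal_Form"
    "Jordan_Normal_Form.Spectral_Radius"
    "HOL-Computational_Algebra.Polynomial"
begin

definition gen_eigenvector_of_rank ::
    "complex mat \<Rightarrow> complex \<Rightarrow> nat \<Rightarrow> complex vec \<Rightarrow> bool" where
  "gen_eigenvector_of_rank A lam k v \<longleftrightarrow>
     (let n = dim_row A; N = A - lam \<cdot>\<^sub>m 1\<^sub>m n in
        0 < k \<and> v \<in> carrier_vec n \<and>
        (N ^\<^sub>m k) *\<^sub>v v = 0\<^sub>v n \<and> (N ^\<^sub>m (k - 1)) *\<^sub>v v \<noteq> 0\<^sub>v n)"

definition jordan_chain ::
    "complex mat \<Rightarrow> complex \<Rightarrow> nat \<Rightarrow> (nat \<Rightarrow> complex vec) \<Rightarrow> bool" where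
  "jordan_chain A lam r x \<longleftrightarrow>
     x 0 = 0\<^sub>v (dim_row A) \<and>
     (\<forall>j\<in>{1..r}. gen_eigenvector_of_rank A lam j (x j) \<and>
                 A *\<^sub>v x j = lam \<cdot>\<^sub>v x j + x (j - 1))"

text \<open>The rank-one matrix $v w^*$.\<close>

definition outer_prod :: "complex vec \<Rightarrow> complex vec \<Rightarrow> complex mat" where
  "outer_prod v w = mat (dim_vec v) (dim_vec w) (\<lambda>(i, j). v $ i * cnj (w $ j))"

text \<open>$f(t) = (t - lam)^m - b^* \sum_{i=0}^{m-1} (t - lam)^i x_{i+1}$; the library's
  \<open>u \<bullet>c b\<close> conjugates its second argument, so it is $b^* u$.\<close>

definition chain_fun ::
    "nat \<Rightarrow> complex \<Rightarrow> nat \<Rightarrow> (nat \<Rightarrow> complex vec) \<Rightarrow> complex vec \<Rightarrow> complex \<Rightarrow> complex" where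
  "chain_fun n lam m x b t =
     (t - lam) ^ m -
       finsum_vec TYPE(complex) n (\<lambda>i. (t - lam) ^ i \<cdot>\<^sub>v x (i + 1)) {0..<m} \<bullet>c b"

definition eigenvalues_mset :: "complex mat \<Rightarrow> complex multiset" where
  "eigenvalues_mset A = proots (char_poly A)"

end

theory Submission
  imports Defs
begin

text \<open>Along the Jordan chain the resolvent is explicit:
  \<open>(t - A)\<^sup>-\<^sup>1 x\<^sub>m = (t - \<lambda>)\<^sup>-\<^sup>m \<Sum>\<^sub>i (t - \<lambda>)\<^sup>i x\<^sub>i\<^sub>+\<^sub>1\<close>. With the
  matrix determinant lemma this gives \<open>(t - \<lambda>)\<^sup>m p\<^sub>B(t) = p\<^sub>A(t) f(t)\<close> for the characteristic
  polynomials of \<open>A\<close> and \<open>B = A + x\<^sub>m b\<^sup>*\<close>. The block \<open>J\<^sub>r(\<lambda>)\<close> forces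
  \<open>p\<^sub>A(t) = (t - \<lambda>)\<^sup>m q(t)\<close>, hence \<open>p\<^sub>B = q f\<close>: the perturbation replaces \<open>m\<close> copies of \<open>\<lambda>\<close> by the
  zeros of the monic polynomial \<open>f\<close>.\<close>

section \<open>Determinants of rank-one perturbations\<close>

text \<open>Sylvester's determinant identity: both sides equal \<open>det ?M\<close>. Multiplying
  \<open>?M\<close> by the unit lower triangular \<open>?L\<close> clears the block
  \<open>V\<close>; on the right this leaves \<open>U * V\<close> in the first diagonal block, on
  the left \<open>V * U\<close> in the second.\<close>

lemma det_one_plus_mult_commute:
  fixes U V :: "'a :: idom mat"
  assumes U: "U \<in> carrier_mat n k" and V: "V \<in> carrier_mat k n"
  shows "det (1\<^sub>m n + U * V) = det (1\<^sub>m k + V * U)"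
proof -
  let ?M = "four_block_mat (1\<^sub>m n) (- U) V (1\<^sub>m k)"
  let ?L = "four_block_mat (1\<^sub>m n) (0\<^sub>m n k) (- V) (1\<^sub>m k)"
  have M: "?M \<in> carrier_mat (n + k) (n + k)" and L: "?L \<in> carrier_mat (n + k) (n + k)"
    by auto
  have detL: "det ?L = 1"
    using U V by (subst det_four_block_mat_upper_right_zero[of _ n _ k]) auto
  have "det ?M = det (?M * ?L)"
    using det_mult[OF M L] detL by simp
  also have "?M * ?L = four_block_mat (1\<^sub>m n + U * V) (- U) (0\<^sub>m k n) (1\<^sub>m k)"
    using U V by (subst mult_four_block_mat[of _ n n _ k _ k _ _ n _ k]) auto
  also have "det \<dots> = det (1\<^sub>m n + U * V)"
    using U V by (subst det_four_block_mat_lower_left_zero[of _ n _ k]) auto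
  finally have 1: "det ?M = det (1\<^sub>m n + U * V)" .
  have "det ?M = det (?L * ?M)"
    using det_mult[OF L M] detL by simp
  also have "?L * ?M = four_block_mat (1\<^sub>m n) (- U) (0\<^sub>m k n) (1\<^sub>m k + V * U)"
    using U V by (subst mult_four_block_mat[of _ n n _ k _ k _ _ n _ k])
      (auto simp: comm_add_mat[of "V * U" k k])
  also have "det \<dots> = det (1\<^sub>m k + V * U)"
    using U V by (subst det_four_block_mat_lower_left_zero[of _ n _ k]) auto
  finally show ?thesis
    using 1 by simp
qed

lemma outer_prod_carrier:
  "v \<in> carrier_vec n \<Longrightarrow> w \<in> carrier_vec k \<Longrightarrow> outer_prod v w \<in> carrier_mat n k"
  by (simp add: outer_prod_def carrier_vecD)

lemma mult_outer_prod:
  assumes "M \<in> carrier_mat k n" "v \<in> carrier_vec n"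
  shows "M * outer_prod v w = outer_prod (M *\<^sub>v v) w"
proof (rule eq_matI)
  fix i j assume "i < dim_row (outer_prod (M *\<^sub>v v) w)" "j < dim_col (outer_prod (M *\<^sub>v v) w)"
  then show "(M * outer_prod v w) $$ (i, j) = outer_prod (M *\<^sub>v v) w $$ (i, j)"
    using assms
    by (auto simp: outer_prod_def scalar_prod_def sum_distrib_right mult.assoc intro!: sum.cong)
qed (use assms in \<open>auto simp: outer_prod_def\<close>)

text \<open>The outer product is a column times a row, so exchanging the factors leaves a 1 by 1
  determinant.\<close>

lemma det_one_plus_outer_prod:
  assumes "v \<in> carrier_vec n" "w \<in> carrier_vec n"
  shows "det (1\<^sub>m n + outer_prod v w) = 1 + v \<bullet>c w"
proof -
  let ?U = "mat n 1 (\<lambda>(i, j). v $ i)" and ?V = "mat 1 n (\<lambda>(i, j). cnj (w $ j))"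
  have "outer_prod v w = ?U * ?V"
    using assms by (intro eq_matI) (auto simp: outer_prod_def scalar_prod_def)
  moreover have "det (1\<^sub>m n + ?U * ?V) = det (1\<^sub>m 1 + ?V * ?U)"
    by (rule det_one_plus_mult_commute) auto
  moreover have "det (1\<^sub>m 1 + ?V * ?U) = 1 + v \<bullet>c w"
    using assms by (subst det_single) (auto simp: scalar_prod_def mult.commute intro!: sum.cong)
  ultimately show ?thesis
    by simp
qed

text \<open>With the update column written as \<open>M *\<^sub>v v\<close>, the factor
  \<open>M\<close> comes out on the left. This is the matrix determinant lemma in a form that
  mentions no inverse.\<close>

lemma det_add_outer_prod_mult_vec:
  assumes M: "M \<in> carrier_mat n n" and v: "v \<in> carrier_vec n" and w: "w \<in> carrier_vec n"
  shows "det (M + outer_prod (M *\<^sub>v v) w) = det M * (1 + v \<bullet>c w)"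
proof -
  have P: "outer_prod v w \<in> carrier_mat n n"
    using v w by (rule outer_prod_carrier)
  have "M + outer_prod (M *\<^sub>v v) w = M * (1\<^sub>m n + outer_prod v w)"
    using M P by (simp add: mult_add_distrib_mat[of M n n _ n] mult_outer_prod[OF M v])
  then show ?thesis
    using M P by (simp add: det_mult[OF M] det_one_plus_outer_prod[OF v w])
qed

section \<open>The resolvent along a Jordan chain\<close>

definition chain_sum ::
    "nat \<Rightarrow> complex \<Rightarrow> nat \<Rightarrow> (nat \<Rightarrow> complex vec) \<Rightarrow> complex \<Rightarrow> complex vec" where
  "chain_sum n lam m x t = finsum_vec TYPE(complex) n (\<lambda>i. (t - lam) ^ i \<cdot>\<^sub>v x (i + 1)) {0..<m}"

lemma jordan_chainD:
  assumes "A \<in> carrier_mat n n" "jordan_chain A lam r x"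
  shows jordan_chain_0: "x 0 = 0\<^sub>v n"
    and jordan_chain_carrier: "j \<le> r \<Longrightarrow> x j \<in> carrier_vec n"
    and jordan_chain_Suc: "Suc j \<le> r \<Longrightarrow> A *\<^sub>v x (Suc j) = lam \<cdot>\<^sub>v x (Suc j) + x j"
proof -
  show 0: "x 0 = 0\<^sub>v n"
    using assms by (auto simp: jordan_chain_def)
  show "x j \<in> carrier_vec n" if "j \<le> r"
    using assms that 0
    by (cases j) (auto simp: jordan_chain_def gen_eigenvector_of_rank_def Let_def)
  show "A *\<^sub>v x (Suc j) = lam \<cdot>\<^sub>v x (Suc j) + x j" if "Suc j \<le> r"
    using assms that by (auto simp: jordan_chain_def)
qed

text \<open>Up to the factor \<open>(t - lam) ^ m\<close>, the sum is the resolvent of \<open>A\<close> at \<open>t\<close> applied to \<open>x m\<close>: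
  along the chain \<open>t - A\<close> acts as \<open>x j \<mapsto> (t - lam) x j - x (j - 1)\<close>, so the images telescope.\<close>

lemma mult_chain_sum:
  assumes A: "A \<in> carrier_mat n n" and chain: "jordan_chain A lam r x" and "m \<le> r"
  shows "chain_sum n lam m x t \<in> carrier_vec n"
    and "- char_matrix A t *\<^sub>v chain_sum n lam m x t = (t - lam) ^ m \<cdot>\<^sub>v x m"
proof -
  have car: "(\<lambda>i. (t - lam) ^ i \<cdot>\<^sub>v x (i + 1)) \<in> {0..<k} \<rightarrow> carrier_vec n" if "k \<le> r" for k
    using jordan_chain_carrier[OF A chain] that by auto
  have sum_carrier: "chain_sum n lam k x t \<in> carrier_vec n" if "k \<le> r" for k
    unfolding chain_sum_def using car[OF that] by (rule finsum_vec_closed)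
  show "chain_sum n lam m x t \<in> carrier_vec n"
    using \<open>m \<le> r\<close> by (rule sum_carrier)
  \<comment> \<open>\<open>char_matrix A t\<close> stands for A - t I; its negative t I - A has the
    value of \<open>char_poly A\<close> at \<open>t\<close> as determinant.\<close>
  let ?M = "- char_matrix A t"
  have M: "?M \<in> carrier_mat n n"
    using A by simp
  show "?M *\<^sub>v chain_sum n lam m x t = (t - lam) ^ m \<cdot>\<^sub>v x m"
    using \<open>m \<le> r\<close>
  proof (induction m)
    case 0
    \<comment> \<open>The empty sum matches the right-hand side because the chain is extended by
      \<open>x 0 = 0\<close>.\<close>
    then show ?case
      using M jordan_chain_0[OF A chain]
      by (intro eq_vecI) (auto simp: chain_sum_def finsum_vec_empty scalar_prod_def)
  next
    case (Suc m)
    have xm: "x m \<in> carrier_vec n" and xSm: "x (Suc m) \<in> carrier_vec n"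
      using Suc.prems jordan_chain_carrier[OF A chain] by simp_all
    have "chain_sum n lam (Suc m) x t =
        (t - lam) ^ m \<cdot>\<^sub>v x (Suc m) + chain_sum n lam m x t"
      unfolding chain_sum_def atLeast0_lessThan_Suc
      using Suc.prems car[of m] xSm by (subst finsum_vec_insert) auto
    \<comment> \<open>The last summand is the induction hypothesis; it cancels against the
      \<open>- x m\<close> that \<open>?M\<close> produces from the new top vector.\<close>
    then have "?M *\<^sub>v chain_sum n lam (Suc m) x t =
        (t - lam) ^ m \<cdot>\<^sub>v (?M *\<^sub>v x (Suc m)) + (t - lam) ^ m \<cdot>\<^sub>v x m"
      using Suc xSm sum_carrier[of m]
      by (simp add: mult_add_distrib_mat_vec[OF M] mult_mat_vec[OF M])
    moreover have "?M *\<^sub>v x (Suc m) = (t - lam) \<cdot>\<^sub>v x (Suc m) - x m"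
    proof -
      have "?M *\<^sub>v x (Suc m) = t \<cdot>\<^sub>v x (Suc m) - A *\<^sub>v x (Suc m)"
      proof -
        have smult_mat_mult_vec: "(t \<cdot>\<^sub>m 1\<^sub>m n) *\<^sub>v x (Suc m) = t \<cdot>\<^sub>v x (Suc m)"
          using xSm by (intro eq_vecI) auto
        have "?M = t \<cdot>\<^sub>m 1\<^sub>m n - A"
          using A by (intro eq_matI) (auto simp: char_matrix_def)
        then show ?thesis
          using A xSm by (simp add: minus_mult_distrib_mat_vec[of _ n n] smult_mat_mult_vec)
      qed
      then show ?thesis
        using xm xSm
        by (auto simp: jordan_chain_Suc[OF A chain Suc.prems] intro!: eq_vecI) (simp add: algebra_simps)
    qed
    ultimately show ?case
      using xm xSm by (intro eq_vecI) (auto simp: algebra_simps)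
  qed
qed

section \<open>The function f as a monic polynomial\<close>

text \<open>The polynomial behind \<open>chain_fun\<close>, which gives access to degree,
  cancellation and the multiset of roots.\<close>

definition chain_poly ::
    "complex \<Rightarrow> nat \<Rightarrow> (nat \<Rightarrow> complex vec) \<Rightarrow> complex vec \<Rightarrow> complex poly" where
  "chain_poly lam m x b =
     [:- lam, 1:] ^ m - (\<Sum>i<m. Polynomial.smult (x (i + 1) \<bullet>c b) ([:- lam, 1:] ^ i))"

lemma poly_chain_poly:
  assumes b: "b \<in> carrier_vec n" and x: "\<And>j. 0 < j \<Longrightarrow> j \<le> m \<Longrightarrow> x j \<in> carrier_vec n"
  shows "poly (chain_poly lam m x b) t = chain_fun n lam m x b t"
proof -
  let ?v = "\<lambda>i. (t - lam) ^ i \<cdot>\<^sub>v x (i + 1)"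
  have dim: "dim_vec (x (Suc i)) = n" if "i < m" for i
    using x[of "Suc i"] that by auto
  have "finsum_vec TYPE(complex) n ?v {0..<m} \<bullet>c b
      = (\<Sum>j<n. (\<Sum>i<m. (t - lam) ^ i * x (i + 1) $ j) * cnj (b $ j))"
    using b x
    by (auto simp: dim scalar_prod_def lessThan_atLeast0 index_finsum_vec[OF finite_atLeastLessThan] Pi_iff carrier_vecD
        intro!: sum.cong)
  also have "\<dots> = (\<Sum>i<m. \<Sum>j<n. (t - lam) ^ i * x (i + 1) $ j * cnj (b $ j))"
    unfolding sum_distrib_right by (rule sum.swap)
  also have "\<dots> = (\<Sum>i<m. (t - lam) ^ i * (x (i + 1) \<bullet>c b))"
    using b by (auto simp: scalar_prod_def lessThan_atLeast0 sum_distrib_left mult.assoc intro!: sum.cong)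
  finally show ?thesis
    by (simp add: chain_poly_def chain_fun_def poly_sum mult.commute)
qed

text \<open>The subtracted sum has no coefficient at index \<open>m\<close> or above, so the top
  term is that of \<open>[:- lam, 1:] ^ m\<close>.\<close>

lemma degree_chain_poly: "degree (chain_poly lam m x b) = m"
  and lead_coeff_chain_poly: "lead_coeff (chain_poly lam m x b) = 1"
proof -
  let ?S = "\<Sum>i<m. Polynomial.smult (x (i + 1) \<bullet>c b) ([:- lam, 1:] ^ i)"
  have S: "coeff ?S k = 0" if "m \<le> k" for k
    using that by (auto simp: coeff_sum degree_linear_power intro!: sum.neutral coeff_eq_0)
  have m: "coeff (chain_poly lam m x b) m = 1"
    using S[of m] by (simp add: chain_poly_def coeff_linear_power)
  have "coeff (chain_poly lam m x b) k = 0" if "m < k" for k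
    using that S[of k] by (simp add: chain_poly_def coeff_eq_0 degree_linear_power)
  then have "degree (chain_poly lam m x b) \<le> m"
    by (intro degree_le) auto
  with m show deg: "degree (chain_poly lam m x b) = m"
    by (intro antisym le_degree) auto
  show "lead_coeff (chain_poly lam m x b) = 1"
    using m by (simp add: deg)
qed

section \<open>Comparison of the characteristic polynomials\<close>

text \<open>The resolvent formula gives equality of values at every \<open>t \<noteq> lam\<close>;
  polynomials that agree off a single point are equal.\<close>

lemma char_poly_add_outer_prod_chain:
  assumes A: "A \<in> carrier_mat n n" and chain: "jordan_chain A lam r x" and "m \<le> r"
    and b: "b \<in> carrier_vec n"
  shows "[:- lam, 1:] ^ m * char_poly (A + outer_prod (x m) b) = char_poly A * chain_poly lam m x b"
    (is "?L ^ m * char_poly ?B = _")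
proof -
  have xm: "x m \<in> carrier_vec n"
    using jordan_chain_carrier[OF A chain \<open>m \<le> r\<close>] .
  have B: "?B \<in> carrier_mat n n"
    using A outer_prod_carrier[OF xm b] by simp
  have off_lam: "(t - lam) ^ m * poly (char_poly ?B) t = poly (char_poly A) t * chain_fun n lam m x b t"
    if "t \<noteq> lam" for t
  proof -
    define s where "s = (t - lam) ^ m"
    have "s \<noteq> 0"
      using that by (simp add: s_def)
    let ?M = "- char_matrix A t" and ?y = "chain_sum n lam m x t"
    \<comment> \<open>The scaling makes \<open>?M *\<^sub>v v = - x m\<close>, the column by which t
      I - B differs from t I - A.\<close>
    define v where "v = (- (1 / s)) \<cdot>\<^sub>v ?y"
    have M: "?M \<in> carrier_mat n n"
      using A by simp
    have y: "?y \<in> carrier_vec n" and My: "?M *\<^sub>v ?y = s \<cdot>\<^sub>v x m"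
      unfolding s_def using mult_chain_sum[OF A chain \<open>m \<le> r\<close>] by auto
    have v: "v \<in> carrier_vec n"
      using y by (simp add: v_def)
    have "?M *\<^sub>v v = - x m"
      unfolding v_def mult_mat_vec[OF M y] My
      using \<open>s \<noteq> 0\<close> xm by (intro eq_vecI) auto
    moreover have "- char_matrix ?B t = ?M + outer_prod (- x m) b"
      using A b xm by (intro eq_matI) (auto simp: char_matrix_def outer_prod_def)
    ultimately have "poly (char_poly ?B) t = det (?M + outer_prod (?M *\<^sub>v v) b)"
      by (simp add: char_poly_matrix[OF B])
    also have "\<dots> = poly (char_poly A) t * (1 + v \<bullet>c b)"
      by (simp add: det_add_outer_prod_mult_vec[OF M v b] char_poly_matrix[OF A])
    also have "v \<bullet>c b = - (1 / s) * (?y \<bullet>c b)"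
      using y b by (simp add: v_def)
    finally have "s * poly (char_poly ?B) t = poly (char_poly A) t * (s - ?y \<bullet>c b)"
      using \<open>s \<noteq> 0\<close> by (simp add: field_simps)
    then show ?thesis
      unfolding chain_fun_def s_def chain_sum_def .
  qed
  \<comment> \<open>The extra factor \<open>?L\<close> absorbs the excluded point \<open>t = lam\<close>.\<close>
  have "poly (?L * (?L ^ m * char_poly ?B)) t = poly (?L * (char_poly A * chain_poly lam m x b)) t" for t
    using off_lam[of t] jordan_chain_carrier[OF A chain] \<open>m \<le> r\<close> b
    by (cases "t = lam") (simp_all add: poly_chain_poly[where n = n])
  then have "?L * (?L ^ m * char_poly ?B) = ?L * (char_poly A * chain_poly lam m x b)"
    by (intro iffD1[OF poly_eq_poly_eq_iff] ext)
  then show ?thesis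
    by (subst (asm) mult_cancel_left) simp
qed

section \<open>Spectrum and eigenvalue multisets\<close>

theorem theorem3p1:
  fixes A :: "complex mat" and lam :: complex and n r m :: nat
    and x :: "nat \<Rightarrow> complex vec" and b :: "complex vec"
    and blocks :: "(nat \<times> complex) list"
  assumes "A \<in> carrier_mat n n"
    and "eigenvalue A lam"
    and "jordan_nf A blocks" and "(r, lam) \<in> set blocks"
    and "0 < m" and "m \<le> r"
    and "jordan_chain A lam r x"
    and "b \<in> carrier_vec n"
  defines "B \<equiv> A + outer_prod (x m) b"
    and "f \<equiv> chain_fun n lam m x b"
  shows "card (spectrum B - spectrum A) \<le> m \<and>
         (\<forall>\<mu> \<in> spectrum B - spectrum A. f \<mu> = 0) \<and>
         (\<exists>C Z. size Z = m \<and>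
                (\<forall>t. f t = (\<Prod>z\<in>#Z. t - z)) \<and>
                eigenvalues_mset A = C + replicate_mset m lam \<and>
                eigenvalues_mset B = C + Z)"
proof -
  note A = assms(1) and chain = assms(7) and b = assms(8)
  let ?L = "[:- lam, 1:]" and ?F = "chain_poly lam m x b"
  have B: "B \<in> carrier_mat n n"
    using A outer_prod_carrier[OF jordan_chain_carrier[OF A chain \<open>m \<le> r\<close>] b] by (simp add: B_def)
  have cA: "char_poly A \<noteq> 0" and cB: "char_poly B \<noteq> 0"
    using degree_monic_char_poly[OF A] degree_monic_char_poly[OF B] by auto
  have F0: "?F \<noteq> 0"
    using lead_coeff_chain_poly[of lam m x b] by auto
  \<comment> \<open>A Jordan block of size \<open>r\<close> makes \<open>lam\<close> a root of
    multiplicity at least \<open>r\<close>, which is where \<open>m \<le> r\<close> enters.\<close>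
  have "m \<le> Polynomial.order lam (char_poly A)"
    using jordan_nf_block_size_order_bound[OF assms(3,4)] \<open>m \<le> r\<close> by simp
  then have "?L ^ m dvd char_poly A"
    using order_divides by blast
  then obtain q where q: "char_poly A = ?L ^ m * q"
    by (elim dvdE)
  have "?L ^ m * char_poly B = ?L ^ m * (q * ?F)"
    using char_poly_add_outer_prod_chain[OF A chain \<open>m \<le> r\<close> b] q by (simp add: B_def mult.assoc)
  then have qF: "char_poly B = q * ?F"
    by (subst (asm) mult_cancel_left) simp
  have q0: "q \<noteq> 0"
    using cA q by auto
  have f: "f t = poly ?F t" for t
    using poly_chain_poly[OF b, of m x lam t] jordan_chain_carrier[OF A chain] \<open>m \<le> r\<close>
    by (simp add: f_def)
  \<comment> \<open>Roots of \<open>q\<close> are already eigenvalues of \<open>A\<close>, so a new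
    eigenvalue can only come from \<open>?F\<close>.\<close>
  have sub: "spectrum B - spectrum A \<subseteq> {t. poly ?F t = 0}"
    by (auto simp: spectrum_root_char_poly[OF A] spectrum_root_char_poly[OF B] q qF)
  have "card (spectrum B - spectrum A) \<le> card {t. poly ?F t = 0}"
    using sub F0 by (intro card_mono poly_roots_finite)
  also have "\<dots> \<le> m"
    using card_poly_roots_bound[OF F0] by (simp add: degree_chain_poly)
  finally have "card (spectrum B - spectrum A) \<le> m" .
  moreover have "f \<mu> = 0" if "\<mu> \<in> spectrum B - spectrum A" for \<mu>
    using sub that by (auto simp: f)
  \<comment> \<open>The witness for \<open>Z\<close> is \<open>proots ?F\<close>: over the complex
    numbers a polynomial has as many roots, with multiplicity, as its degree.\<close>
  moreover have "size (proots ?F) = m"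
    by (simp add: size_proots_complex degree_chain_poly)
  moreover have "f t = (\<Prod>z\<in>#proots ?F. t - z)" for t
  proof -
    have "?F = (\<Prod>z\<in>#proots ?F. [:- z, 1:])"
      using complex_poly_decompose_multiset[of ?F] by (simp add: lead_coeff_chain_poly)
    then have "poly ?F t = poly (\<Prod>z\<in>#proots ?F. [:- z, 1:]) t"
      by simp
    then show ?thesis
      by (simp add: f poly_prod_mset image_mset.compositionality comp_def)
  qed
  \<comment> \<open>The common part \<open>C\<close> is \<open>proots q\<close>, the roots of the
    factor shared by both characteristic polynomials.\<close>
  moreover have "eigenvalues_mset A = proots q + replicate_mset m lam"
    using q0 by (simp add: eigenvalues_mset_def q proots_mult proots_power)
  moreover have "eigenvalues_mset B = proots q + proots ?F"
    using q0 F0 by (simp add: eigenvalues_mset_def qF proots_mult)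
  ultimately show ?thesis
    by blast
qed

end
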